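(* Let $H$ be a connected graph of order $p \geq 4$ with cyclomatic number $v(H) \geq 2$. Then $rb(K_n, H)$ cannot be bounded from above by a function which is linear in $n$; that is, there are no constants $a, b$ such that $rb(K_n,H) \leq an + b$ for all $n \geq p$.
   Context: For a graph $H$ and an integer $n$, the rainbow number $rb(K_n,H)$ is the minimum number $m$ such that every edge-colouring of the complete graph $K_n$ using at least $m$ colours contains a rainbow (totally multicoloured) copy of $H$, i.e. a subgraph isomorphic to $H$ whose edges all have distinct colours. Equivalently $rb(K_n,H) = f(n,H)+1$, where $f(n,H)$ is the maximum number of colours in an edge-colouring of $K_n$ with no rainbow copy of $H$. The cyclomatic number of a connected graph $G$ is $v(G) = |E(G)| - |V(G)| + 1$. *)

theory Defs
  imports Complex_Main "HOL-Library.Ramsey"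
begin

text \<open>
  A finite simple graph is given by its vertex set \<open>V\<close> and a set \<open>E\<close> of two-element subsets
  of \<open>V\<close>; \<open>nsets V 2\<close> is the set of all of these.
\<close>

definition simple_graph :: "'a set \<Rightarrow> 'a set set \<Rightarrow> bool" where
  "simple_graph V E \<longleftrightarrow> finite V \<and> E \<subseteq> nsets V 2"

definition connected_graph :: "'a set \<Rightarrow> 'a set set \<Rightarrow> bool" where
  "connected_graph V E \<longleftrightarrow>
     V \<noteq> {} \<and> (\<forall>u\<in>V. \<forall>v\<in>V. (u, v) \<in> {(x, y). {x, y} \<in> E}\<^sup>*)"

definition cyclomatic_number :: "'a set \<Rightarrow> 'a set set \<Rightarrow> int" where
  "cyclomatic_number V E = int (card E) - int (card V) + 1"

definition subgraph :: "'a set \<Rightarrow> 'a set set \<Rightarrow> 'a set \<Rightarrow> 'a set set \<Rightarrow> bool" where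
  "subgraph W F V E \<longleftrightarrow> simple_graph W F \<and> W \<subseteq> V \<and> F \<subseteq> E"

definition graph_isomorphic :: "'a set \<Rightarrow> 'a set set \<Rightarrow> 'b set \<Rightarrow> 'b set set \<Rightarrow> bool" where
  "graph_isomorphic V E W F \<longleftrightarrow>
     (\<exists>f. bij_betw f V W \<and> (\<forall>u\<in>V. \<forall>v\<in>V. {u, v} \<in> E \<longleftrightarrow> {f u, f v} \<in> F))"

abbreviation K_verts :: "nat \<Rightarrow> nat set" where
  "K_verts n \<equiv> {..<n}"

abbreviation K_edges :: "nat \<Rightarrow> nat set set" where
  "K_edges n \<equiv> nsets (K_verts n) 2"

text \<open>
  An edge-colouring of the complete graph on \<open>n\<close> vertices is a function \<open>c\<close> into \<open>nat\<close>, of which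
  only the values on \<open>K_edges n\<close> matter. Natural numbers suffice as colours because there are
  only finitely many edges.
\<close>

definition num_colours :: "nat \<Rightarrow> (nat set \<Rightarrow> nat) \<Rightarrow> nat" where
  "num_colours n c = card (c ` K_edges n)"

definition has_rainbow_copy :: "nat \<Rightarrow> (nat set \<Rightarrow> nat) \<Rightarrow> 'a set \<Rightarrow> 'a set set \<Rightarrow> bool" where
  "has_rainbow_copy n c V E \<longleftrightarrow>
     (\<exists>W F. subgraph W F (K_verts n) (K_edges n) \<and> graph_isomorphic V E W F \<and> inj_on c F)"

text \<open>
  The minimum below always exists: for \<open>m > n choose 2\<close> no colouring uses at least \<open>m\<close> colours,
  so the condition holds vacuously.
\<close>

definition rainbow_number :: "nat \<Rightarrow> 'a set \<Rightarrow> 'a set set \<Rightarrow> nat" where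
  "rainbow_number n V E =
     (LEAST m. \<forall>c. m \<le> num_colours n c \<longrightarrow> has_rainbow_copy n c V E)"

end

theory Submission imports Defs begin

text \<open>
  Since \<open>H\<close> has \<open>p\<close> vertices and at least \<open>p + 1\<close> edges, \<open>H\<close> minus any edge still has \<open>p\<close> edges
  on \<open>p\<close> vertices. Let \<open>G\<close> be a graph on \<open>n\<close> vertices in which any \<open>k \<le> p\<close> vertices span fewer
  than \<open>k\<close> edges. Giving the edges of \<open>G\<close> distinct colours and all other edges one further
  colour avoids a rainbow \<open>H\<close>, so the rainbow number exceeds the number of edges of \<open>G\<close>. Such
  \<open>G\<close> can have arbitrarily large average degree: take an edge-maximal one of maximum degree at
  most \<open>d\<close>. By maximality any two vertices of degree less than \<open>d\<close> lie in a common set of at most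
  \<open>p\<close> vertices which spans a tree, so all of these vertices lie in one ball of radius \<open>p\<close>, and
  their number is bounded independently of \<open>n\<close>.
\<close>

section \<open>Graphs without short cycles, and their balls\<close>

text \<open>For a set \<open>F\<close> of two-element edges this is girth greater than
  \<open>p\<close>, phrased by counting edges so that no cycles or paths have to be handled.\<close>

definition locally_sparse :: "nat \<Rightarrow> 'a set set \<Rightarrow> bool" where
  "locally_sparse p F \<longleftrightarrow>
     (\<forall>S. finite S \<and> S \<noteq> {} \<and> card S \<le> p \<longrightarrow> card {e \<in> F. e \<subseteq> S} < card S)"

definition degree_in :: "'a set set \<Rightarrow> 'a \<Rightarrow> nat" where
  "degree_in F v = card {e \<in> F. v \<in> e}"

fun graph_ball :: "'a set set \<Rightarrow> 'a \<Rightarrow> nat \<Rightarrow> 'a set" where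
  "graph_ball F u 0 = {u}"
| "graph_ball F u (Suc k) = (\<Union>v\<in>graph_ball F u k. insert v (\<Union>{e \<in> F. v \<in> e}))"

lemma card_insert_le_Suc: "card (insert x A) \<le> Suc (card A)"
  by (rule card_insert_le_m1) auto

lemma graph_ball_mono: "graph_ball F u k \<subseteq> graph_ball F u (Suc k)"
  by auto

lemma centre_in_graph_ball: "u \<in> graph_ball F u k"
  by (induction k) auto

text \<open>Each vertex contributes itself and at most \<open>d\<close> edges with two ends each,
  whence the factor \<open>2 * d + 1\<close>. What matters later is that the bound is independent of
  \<open>V\<close>.\<close>

lemma card_graph_ball_le:
  assumes F: "F \<subseteq> nsets V 2" "finite F" and deg: "\<And>v. degree_in F v \<le> d"
  shows "finite (graph_ball F u k) \<and> card (graph_ball F u k) \<le> (2 * d + 1) ^ k"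
proof (induction k)
  case 0
  then show ?case by simp
next
  case (Suc k)
  have e: "finite e \<and> card e = 2" if "e \<in> F" for e
    using that F(1) by (auto simp: nsets_def)
  have b: "finite (insert v (\<Union>{e \<in> F. v \<in> e}))
      \<and> card (insert v (\<Union>{e \<in> F. v \<in> e})) \<le> 2 * d + 1" for v
  proof
    show "finite (insert v (\<Union>{e \<in> F. v \<in> e}))"
      using F(2) e by auto
    have "card (\<Union>{e \<in> F. v \<in> e}) \<le> (\<Sum>e\<in>{e \<in> F. v \<in> e}. card e)"
      by (rule card_Union_le_sum_card)
    also have "\<dots> = (\<Sum>e\<in>{e \<in> F. v \<in> e}. 2)"
      by (rule sum.cong) (auto simp: e)
    also have "\<dots> \<le> 2 * d"
      using deg[of v] by (simp add: degree_in_def)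
    finally show "card (insert v (\<Union>{e \<in> F. v \<in> e})) \<le> 2 * d + 1"
      using card_insert_le_m1[of "2 * d + 1" "\<Union>{e \<in> F. v \<in> e}" v] by simp
  qed
  have "card (graph_ball F u (Suc k))
      \<le> (\<Sum>v\<in>graph_ball F u k. card (insert v (\<Union>{e \<in> F. v \<in> e})))"
    using Suc by (simp only: graph_ball.simps) (rule card_UN_le, blast)
  also have "\<dots> \<le> card (graph_ball F u k) * (2 * d + 1)"
    using sum_bounded_above[of "graph_ball F u k"
        "\<lambda>v. card (insert v (\<Union>{e \<in> F. v \<in> e}))" "2 * d + 1"] b by simp
  also have "\<dots> \<le> (2 * d + 1) ^ k * (2 * d + 1)"
    using Suc by (intro mult_right_mono) auto
  finally have "card (graph_ball F u (Suc k)) \<le> (2 * d + 1) ^ Suc k"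
    by (simp only: power_Suc2)
  moreover have "finite (graph_ball F u (Suc k))"
    unfolding graph_ball.simps by (rule finite_UN_I[OF conjunct1[OF Suc] conjunct1[OF b]])
  ultimately show ?case by blast
qed

text \<open>The hypothesis \<open>tight\<close> forces \<open>S\<close> to span a tree, so every
  vertex of \<open>S\<close> is close to \<open>u\<close>. Counting replaces paths: while
  \<open>S\<close> is not exhausted, some edge inside \<open>S\<close> leaves the ball.\<close>

lemma tight_set_subset_graph_ball:
  assumes F: "F \<subseteq> nsets V 2" "finite F" and sparse: "locally_sparse p F"
    and S: "finite S" "card S \<le> p" "u \<in> S"
    and tight: "card S \<le> Suc (card {e \<in> F. e \<subseteq> S})"
  shows "S \<subseteq> graph_ball F u p"
proof -
  \<comment> \<open>The centre gives the case \<open>k = 0\<close>; at \<open>k = p\<close> the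
    second alternative contradicts \<open>card S \<le> p\<close>.\<close>
  have "S \<subseteq> graph_ball F u k \<or> k < card (S \<inter> graph_ball F u k)" for k
  proof (induction k)
    case 0
    then show ?case using S by simp
  next
    case (Suc k)
    let ?A = "S \<inter> graph_ball F u k" and ?B = "S - graph_ball F u k"
    show ?case
    proof (cases "S \<subseteq> graph_ball F u k")
      case True
      then show ?thesis using graph_ball_mono[of F u k] by blast
    next
      case False
      have A: "finite ?A" "?A \<noteq> {}" "card ?A \<le> p"
        using S centre_in_graph_ball[of u F k] card_mono[of S ?A] by auto
      have B: "finite ?B" "?B \<noteq> {}" "card ?B \<le> p"
        using S False card_mono[of S ?B] by auto
      have AB: "card ?A + card ?B = card S"
        using card_Int_Diff[OF S(1), of "graph_ball F u k"] by simp
      \<comment> \<open>The two parts together span at most \<open>card S - 2\<close> edges, while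
        \<open>tight\<close> provides at least \<open>card S - 1\<close>; so some edge crosses
        between them.\<close>
      have "card {e \<in> F. e \<subseteq> ?A} < card ?A" "card {e \<in> F. e \<subseteq> ?B} < card ?B"
        using sparse A B unfolding locally_sparse_def by blast+
      then have "card ({e \<in> F. e \<subseteq> ?A} \<union> {e \<in> F. e \<subseteq> ?B}) < card {e \<in> F. e \<subseteq> S}"
        using card_Un_le[of "{e \<in> F. e \<subseteq> ?A}" "{e \<in> F. e \<subseteq> ?B}"] AB tight by linarith
      then have "\<not> {e \<in> F. e \<subseteq> S} \<subseteq> {e \<in> F. e \<subseteq> ?A} \<union> {e \<in> F. e \<subseteq> ?B}"
        using F(2) card_mono[of "{e \<in> F. e \<subseteq> ?A} \<union> {e \<in> F. e \<subseteq> ?B}" "{e \<in> F. e \<subseteq> S}"]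
        by (auto simp: not_le)
      then obtain e where "e \<in> F" "e \<subseteq> S" "\<not> e \<subseteq> ?A" "\<not> e \<subseteq> ?B"
        by blast
      then obtain x y where xy: "x \<in> e" "x \<in> S" "x \<notin> graph_ball F u k"
        "y \<in> e" "y \<in> graph_ball F u k"
        by blast
      then have "x \<in> graph_ball F u (Suc k)"
        using \<open>e \<in> F\<close> by auto
      then have "insert x ?A \<subseteq> S \<inter> graph_ball F u (Suc k)"
        using xy(2) graph_ball_mono[of F u k] by blast
      then have "card (insert x ?A) \<le> card (S \<inter> graph_ball F u (Suc k))"
        using S(1) by (intro card_mono) auto
      moreover have "k < card ?A"
        using Suc False by blast
      ultimately show ?thesis
        using xy(3) A(1) by simp
    qed
  qed
  from this[of p] show ?thesis
    using S card_mono[of S "S \<inter> graph_ball F u p"] by fastforce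
qed

section \<open>Dense graphs that are locally sparse\<close>

lemma sum_degree_in:
  assumes "finite V" "F \<subseteq> nsets V 2"
  shows "(\<Sum>v\<in>V. degree_in F v) = 2 * card F"
proof -
  have "finite F"
    using assms finite_imp_finite_nsets finite_subset by blast
  have "(\<Sum>v\<in>V. card {e \<in> F. v \<in> e}) = (\<Sum>e\<in>F. 2)"
  proof (rule sum_multicount_gen[OF assms(1) \<open>finite F\<close>], intro ballI)
    fix e assume "e \<in> F"
    then have "e \<subseteq> V" "card e = 2"
      using assms(2) by (auto simp: nsets_def)
    then show "card {v \<in> V. v \<in> e} = 2"
      by (simp add: Collect_conj_eq Int_absorb1)
  qed
  then show ?thesis by (simp add: degree_in_def)
qed

text \<open>All but at most \<open>(2 * d + 1) ^ p\<close> vertices of a maximal graph have degree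
  \<open>d\<close>, and the degree sum counts every edge twice. Truncated subtraction makes the
  bound trivial for small \<open>V\<close>.\<close>

lemma dense_locally_sparse_graph_exists:
  assumes V: "finite V" and "2 \<le> p"
  obtains F where "F \<subseteq> nsets V 2" "locally_sparse p F"
    "d * (card V - (2 * d + 1) ^ p) \<le> 2 * card F"
proof -
  define P where
    "P F \<longleftrightarrow> F \<subseteq> nsets V 2 \<and> locally_sparse p F \<and> (\<forall>v. degree_in F v \<le> d)" for F
  have fin: "finite (nsets V 2)"
    using V by (rule finite_imp_finite_nsets)
  have "P {}"
    by (auto simp: P_def locally_sparse_def degree_in_def card_gt_0_iff)
  moreover have "\<forall>F. P F \<longrightarrow> card F \<le> card (nsets V 2)"
    using fin unfolding P_def by (blast intro: card_mono)
  ultimately obtain F where F: "P F" and max: "\<And>G. P G \<Longrightarrow> card G \<le> card F"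
    using ex_has_greatest_nat[of P "{}" card "Suc (card (nsets V 2))"] by (metis less_Suc_eq_le)
  have Fsub: "F \<subseteq> nsets V 2" and sparse: "locally_sparse p F"
    and deg: "\<And>v. degree_in F v \<le> d"
    using F by (auto simp: P_def)
  have finF: "finite F"
    using Fsub fin finite_subset by blast
  define U where "U = {v \<in> V. degree_in F v < d}"
  \<comment> \<open>Otherwise \<open>{u, v}\<close> could be added: both ends have degree below
    \<open>d\<close>, so only a violation of local sparsity can prevent it, and that yields a tight
    set containing \<open>u\<close> and \<open>v\<close>.\<close>
  have ball: "v \<in> graph_ball F u p" if uv: "u \<in> U" "v \<in> U" for u v
  proof (rule ccontr)
    assume nin: "v \<notin> graph_ball F u p"
    have "u \<noteq> v"
      using nin centre_in_graph_ball by metis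
    let ?G = "insert {u, v} F"
    have tight_imp: False
      if S: "finite S" "card S \<le> p" "u \<in> S" "v \<in> S" "card S \<le> Suc (card {e \<in> F. e \<subseteq> S})" for S
      using tight_set_subset_graph_ball[OF Fsub finF sparse S(1,2,3,5)] S(4) nin by blast
    \<comment> \<open>An edge is itself a tight set, of size \<open>2 \<le> p\<close>.\<close>
    have "{u, v} \<notin> F"
    proof
      assume "{u, v} \<in> F"
      then have "0 < card {e \<in> F. e \<subseteq> {u, v}}"
        using finF by (auto simp: card_gt_0_iff)
      then show False
        using tight_imp[of "{u, v}"] \<open>u \<noteq> v\<close> \<open>2 \<le> p\<close> by simp
    qed
    have "\<not> P ?G"
      using max[of ?G] finF \<open>{u, v} \<notin> F\<close> by auto
    moreover have "?G \<subseteq> nsets V 2"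
      using Fsub uv \<open>u \<noteq> v\<close> by (auto simp: U_def nsets_def)
    moreover have "degree_in ?G x \<le> d" for x
    proof (cases "x \<in> {u, v}")
      case True
      then have "{e \<in> ?G. x \<in> e} = insert {u, v} {e \<in> F. x \<in> e}" by blast
      then have "degree_in ?G x \<le> Suc (degree_in F x)"
        unfolding degree_in_def by (simp only: card_insert_le_Suc)
      moreover have "degree_in F x < d"
        using True uv by (auto simp: U_def)
      ultimately show ?thesis by simp
    next
      case False
      then have "{e \<in> ?G. x \<in> e} = {e \<in> F. x \<in> e}" by blast
      then show ?thesis using deg[of x] by (simp only: degree_in_def)
    qed
    ultimately have "\<not> locally_sparse p ?G"
      by (simp add: P_def)
    then obtain S where S: "finite S" "S \<noteq> {}" "card S \<le> p" "card S \<le> card {e \<in> ?G. e \<subseteq> S}"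
      unfolding locally_sparse_def by (metis not_less)
    \<comment> \<open>A violating set must contain the new edge; removing that edge leaves
      \<open>S\<close> tight in \<open>F\<close>.\<close>
    have "{u, v} \<subseteq> S"
    proof (rule ccontr)
      assume "\<not> {u, v} \<subseteq> S"
      then have "{e \<in> ?G. e \<subseteq> S} = {e \<in> F. e \<subseteq> S}" by blast
      then show False
        using sparse S unfolding locally_sparse_def by fastforce
    qed
    then have "{e \<in> ?G. e \<subseteq> S} = insert {u, v} {e \<in> F. e \<subseteq> S}" by blast
    then have "card {e \<in> ?G. e \<subseteq> S} \<le> Suc (card {e \<in> F. e \<subseteq> S})"
      by (simp only: card_insert_le_Suc)
    then show False
      using tight_imp[of S] S \<open>{u, v} \<subseteq> S\<close> by simp
  qed
  have "card U \<le> (2 * d + 1) ^ p"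
  proof (cases "U = {}")
    case False
    then obtain u where "u \<in> U" by blast
    then have "U \<subseteq> graph_ball F u p" using ball by blast
    then show ?thesis
      using card_graph_ball_le[OF Fsub finF deg, of u p] card_mono le_trans by blast
  qed simp
  then have "d * (card V - (2 * d + 1) ^ p) \<le> d * card (V - U)"
    using V by (intro mult_left_mono) (auto simp: U_def card_Diff_subset)
  also have "\<dots> = (\<Sum>v\<in>V - U. d)" by simp
  also have "\<dots> \<le> (\<Sum>v\<in>V - U. degree_in F v)"
    by (intro sum_mono) (auto simp: U_def)
  also have "\<dots> \<le> (\<Sum>v\<in>V. degree_in F v)"
    using V by (intro sum_mono2) auto
  also have "\<dots> = 2 * card F"
    using V Fsub by (rule sum_degree_in)
  finally show thesis using that Fsub sparse by blast
qed

section \<open>Colourings from locally sparse graphs\<close>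

text \<open>A rainbow copy uses the extra colour at most once, so at least
  \<open>card E - 1 \<ge> card V\<close> of its edges lie in \<open>F\<close>, too many for
  \<open>card V\<close> vertices.\<close>

lemma rainbow_number_gt:
  assumes H: "simple_graph V E" and E: "card V < card E" "V \<noteq> {}"
    and F: "F \<subseteq> K_edges n" and sparse: "locally_sparse (card V) F"
  shows "card F < rainbow_number n V E"
proof -
  have finF: "finite F"
    using F finite_imp_finite_nsets[of "K_verts n" 2] finite_subset by blast
  then obtain g :: "nat set \<Rightarrow> nat" where g: "inj_on g F"
    by (metis finite_imp_inj_to_nat_seg)
  \<comment> \<open>The shift by \<open>Suc\<close> reserves colour \<open>0\<close> for the edges
    outside \<open>F\<close>.\<close>
  define c where "c e = (if e \<in> F then Suc (g e) else 0)" for e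
  \<comment> \<open>Only the colours on \<open>F\<close> are counted, since colour \<open>0\<close>
    does not occur if \<open>F\<close> contains every edge.\<close>
  have "inj_on c F"
    using g by (auto simp: inj_on_def c_def)
  then have "card F = card (c ` F)"
    by (simp add: card_image)
  also have "\<dots> \<le> num_colours n c"
    unfolding num_colours_def
    using F by (intro card_mono image_mono finite_imageI finite_imp_finite_nsets) auto
  finally have colours: "card F \<le> num_colours n c" .
  have "\<not> has_rainbow_copy n c V E"
  proof
    assume "has_rainbow_copy n c V E"
    then obtain W F' f where W: "simple_graph W F'" and f: "bij_betw f V W"
      and iso: "\<And>u v. u \<in> V \<Longrightarrow> v \<in> V \<Longrightarrow> {u, v} \<in> E \<longleftrightarrow> {f u, f v} \<in> F'"
      and rb: "inj_on c F'"
      unfolding has_rainbow_copy_def subgraph_def graph_isomorphic_def by blast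
    have finW: "finite W" and F': "F' \<subseteq> nsets W 2" and EV: "E \<subseteq> nsets V 2"
      using W H by (auto simp: simple_graph_def)
    have finF': "finite F'"
      using F' finW finite_imp_finite_nsets finite_subset by blast
    have "card W = card V"
      using f by (simp add: bij_betw_same_card)
    have "inj_on ((`) f) E"
    proof (rule inj_on_subset)
      show "inj_on ((`) f) (Pow V)"
        using f by (simp add: bij_betw_def inj_on_image_Pow)
      show "E \<subseteq> Pow V"
        using EV by (auto simp: nsets_def)
    qed
    moreover have "(`) f ` E \<subseteq> F'"
    proof
      fix y assume "y \<in> (`) f ` E"
      then obtain e where e: "e \<in> E" "y = f ` e" by blast
      then have "e \<subseteq> V" "card e = 2"
        using EV by (auto simp: nsets_def)
      then obtain u v where "e = {u, v}" "u \<in> V" "v \<in> V"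
        unfolding card_2_iff by blast
      then show "y \<in> F'" using e iso[of u v] by simp
    qed
    ultimately have "card E \<le> card F'"
      using finF' by (intro card_inj_on_le)
    have "card (F' - F) = card (c ` (F' - F))"
      using rb by (simp add: card_image inj_on_diff)
    also have "\<dots> \<le> card {0 :: nat}"
      by (intro card_mono) (auto simp: c_def)
    finally have "card (F' - F) \<le> 1" by simp
    then have "card F' \<le> Suc (card (F' \<inter> F))"
      using card_Int_Diff[OF finF', of F] by simp
    moreover have "card (F' \<inter> F) \<le> card {e \<in> F. e \<subseteq> W}"
      using finF F' by (intro card_mono) (auto simp: nsets_def)
    moreover have "card {e \<in> F. e \<subseteq> W} < card W"
    proof -
      have "W \<noteq> {}"
        using f E(2) by (auto simp: bij_betw_def)
      then show ?thesis
        using sparse finW \<open>card W = card V\<close> unfolding locally_sparse_def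
        by (metis order_refl)
    qed
    ultimately show False
      using \<open>card E \<le> card F'\<close> E(1) \<open>card W = card V\<close> by linarith
  qed
  \<comment> \<open>\<open>LEAST\<close> needs a witness: one more than the number of edges exceeds
    every number of colours.\<close>
  moreover have "\<forall>c. rainbow_number n V E \<le> num_colours n c \<longrightarrow> has_rainbow_copy n c V E"
    unfolding rainbow_number_def
  proof (rule LeastI)
    show "\<forall>c. Suc (card (K_edges n)) \<le> num_colours n c \<longrightarrow> has_rainbow_copy n c V E"
    proof (intro allI impI)
      fix c assume "Suc (card (K_edges n)) \<le> num_colours n c"
      moreover have "num_colours n c \<le> card (K_edges n)"
        unfolding num_colours_def by (intro card_image_le finite_imp_finite_nsets) simp
      ultimately show "has_rainbow_copy n c V E" by linarith
    qed
  qed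
  ultimately show ?thesis
    using colours by (meson le_trans not_le)
qed

section \<open>Comparison with a linear bound\<close>

theorem theorem3:
  fixes V :: "'a set" and E :: "'a set set"
  assumes "simple_graph V E"
    and "connected_graph V E"
    and "card V \<ge> 4"
    and "cyclomatic_number V E \<ge> 2"
  shows "\<not> (\<exists>a b :: real. \<forall>n \<ge> card V. real (rainbow_number n V E) \<le> a * real n + b)"
proof
  assume "\<exists>a b :: real. \<forall>n \<ge> card V. real (rainbow_number n V E) \<le> a * real n + b"
  then obtain a b :: real
    where bound: "\<And>n. card V \<le> n \<Longrightarrow> real (rainbow_number n V E) \<le> a * real n + b"
    by blast
  \<comment> \<open>The summand \<open>1\<close> ensures \<open>1 \<le> m\<close>, hence
    \<open>2 \<le> 2 * d + 1\<close>, which gives \<open>card V \<le> N\<close>.\<close>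
  obtain m :: nat where m: "\<bar>a\<bar> + \<bar>b\<bar> + 1 \<le> real m"
    using real_arch_simple by blast
  \<comment> \<open>On \<open>2 * N\<close> vertices at least \<open>N\<close> have degree
    \<open>d\<close>, so \<open>2 * card F \<ge> 4 * m * N\<close>, that is, \<open>card F\<close>
    is at least \<open>m\<close> times the number of vertices.\<close>
  define d where "d = 4 * m"
  define N where "N = (2 * d + 1) ^ card V"
  have "1 \<le> m"
    using m by linarith
  have "card V \<le> N"
  proof -
    have "card V < 2 ^ card V" by (rule less_exp)
    also have "\<dots> \<le> N"
      unfolding N_def using \<open>1 \<le> m\<close> by (intro power_mono) (auto simp: d_def)
    finally show ?thesis by simp
  qed
  obtain F where F: "F \<subseteq> K_edges (2 * N)" "locally_sparse (card V) F"
    and large: "d * (card (K_verts (2 * N)) - (2 * d + 1) ^ card V) \<le> 2 * card F"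
    using dense_locally_sparse_graph_exists[of "K_verts (2 * N)" "card V" d] assms(3) by auto
  have "m * (2 * N) \<le> card F"
    using large[folded N_def] by (simp add: d_def mult_ac)
  also have "card F < rainbow_number (2 * N) V E"
  proof (rule rainbow_number_gt[OF assms(1) _ _ F])
    show "card V < card E"
      using assms(4) by (simp add: cyclomatic_number_def)
    show "V \<noteq> {}"
      using assms(3) by auto
  qed
  finally have "real m * real (2 * N) < real (rainbow_number (2 * N) V E)"
    by (metis of_nat_less_iff of_nat_mult)
  also have "\<dots> \<le> a * real (2 * N) + b"
    using bound[of "2 * N"] \<open>card V \<le> N\<close> by linarith
  also have "\<dots> \<le> \<bar>a\<bar> * real (2 * N) + \<bar>b\<bar> * real (2 * N)"
  proof (rule add_mono)
    show "a * real (2 * N) \<le> \<bar>a\<bar> * real (2 * N)"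
      by (intro mult_right_mono) auto
    \<comment> \<open>This absorbs the constant term \<open>b\<close> into the linear one.\<close>
    have "1 \<le> real (2 * N)"
      using \<open>card V \<le> N\<close> assms(3) by simp
    then have "\<bar>b\<bar> * 1 \<le> \<bar>b\<bar> * real (2 * N)"
      by (intro mult_left_mono) auto
    then show "b \<le> \<bar>b\<bar> * real (2 * N)" by linarith
  qed
  also have "\<dots> = (\<bar>a\<bar> + \<bar>b\<bar>) * real (2 * N)"
    by (simp add: distrib_right)
  also have "\<dots> \<le> real m * real (2 * N)"
    using m by (intro mult_right_mono) auto
  finally show False by simp
qed

end
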